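(* Let $r,m\ge 2$ be integers. If perfect state transfer occurs on $\Gamma_{r,m}$ from $d^*\boldsymbol{e}_x$ to $d^*\boldsymbol{e}_y$ (at some positive integer time) for some vertices $x,y$ of $\Gamma_{r,m}$, then $r\in\{2,3\}$. Moreover, the following hold. (i) For $m\ge 2$ and $\tau\in\{1,2,3\}$, perfect state transfer occurs from $d^*\boldsymbol{e}_{v_1^{(1)}}$ to another vertex type state on $\Gamma_{2,m}$ at time $\tau$ if and only if $m=2$ and $\tau=2$. In this case, the state $d^*\boldsymbol{e}_{v_1^{(1)}}$ transfers to $d^*\boldsymbol{e}_{v_2^{(1)}}$. (ii) For $m\ge 2$ and $\tau\in\{1,2,\dots,11\}$, perfect state transfer occurs from $d^*\boldsymbol{e}_{v_1^{(1)}}$ to another vertex type state on $\Gamma_{3,m}$ at time $\tau$ if and only if $m=2$ and $\tau=6$. In this case, the state $d^*\boldsymbol{e}_{v_1^{(1)}}$ transfers to $d^*\boldsymbol{e}_{v_2^{(1)}}$.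
   Context: For integers $r,m\ge 2$, $\Gamma_{r,m}$ is the complete $r$-partite graph with all partite sets of size $m$: its vertex set is the disjoint union $V_1\cup\dots\cup V_r$ with $V_j=\{v_1^{(j)},v_2^{(j)},\dots,v_m^{(j)}\}$, and $x\in V_i$, $y\in V_j$ are adjacent if and only if $i\neq j$. For a finite simple connected graph $\Gamma=(V,E)$, let $\mathcal{A}=\{(x,y),(y,x)\mid \{x,y\}\in E\}$ be its set of symmetric arcs. For $a=(x,y)\in\mathcal{A}$ the terminus is $t(a)=y$ and the inverse arc is $a^{-1}=(y,x)$. Write $\delta$ for the Kronecker delta and $M^*$ for the conjugate transpose of $M$. Define: - the boundary matrix $d\in\mathbb{C}^{V\times\mathcal{A}}$ by $d_{x,a}=\frac{1}{\sqrt{\deg x}}\,\delta_{x,t(a)}$; - the shift matrix $S\in\mathbb{C}^{\mathcal{A}\times\mathcal{A}}$ by $S_{a,b}=\delta_{a,b^{-1}}$; - the time evolution matrix of the Grover walk $U=S(2d^*d-I)\in\mathbb{C}^{\mathcal{A}\times\mathcal{A}}$. For $x\in V$, $\boldsymbol{e}_x\in\mathbb{C}^V$ is the unit vector with $(\boldsymbol{e}_x)_z=\delta_{x,z}$. A state is a vector $\Phi\in\mathbb{C}^{\mathcal{A}}$ with $\|\Phi\|=1$; a vertex type state is a state of the form $d^*\boldsymbol{e}_x$ with $x\in V$. Perfect state transfer occurs on $\Gamma$ from a state $\Phi$ to a state $\Psi$ at time $\tau$ if there is $\gamma\in\mathbb{C}$ with $|\gamma|=1$ such that $U^{\tau}\Phi=\gamma\Psi$;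 in this case we also say that $\Phi$ transfers to $\Psi$. "Another vertex type state" means a vertex type state $d^*\boldsymbol{e}_y$ with $y\neq v_1^{(1)}$. *)

theory Defs
  imports Complex_Main
begin

section \<open>Finite simple connected graphs\<close>

type_synonym 'v graph = "'v set \<times> 'v set set"

definition verts :: "'v graph \<Rightarrow> 'v set" where
  "verts G = fst G"

definition edges :: "'v graph \<Rightarrow> 'v set set" where
  "edges G = snd G"

definition arcs :: "'v graph \<Rightarrow> ('v \<times> 'v) set" where
  "arcs G = {(x, y). {x, y} \<in> edges G}"

definition degree :: "'v graph \<Rightarrow> 'v \<Rightarrow> nat" where
  "degree G x = card {e \<in> edges G. x \<in> e}"

definition fin_simple_connected :: "'v graph \<Rightarrow> bool" where
  "fin_simple_connected G \<longleftrightarrow>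
     finite (verts G) \<and> verts G \<noteq> {} \<and>
     (\<forall>e \<in> edges G. \<exists>x \<in> verts G. \<exists>y \<in> verts G. x \<noteq> y \<and> e = {x, y}) \<and>
     (\<forall>x \<in> verts G. \<forall>y \<in> verts G. (x, y) \<in> (arcs G)\<^sup>*)"

definition terminus :: "'v \<times> 'v \<Rightarrow> 'v" where
  "terminus a = snd a"

definition inv_arc :: "'v \<times> 'v \<Rightarrow> 'v \<times> 'v" where
  "inv_arc a = (snd a, fst a)"


section \<open>Complex matrices indexed by finite sets\<close>

text \<open>A vector indexed by a finite set \<open>I\<close> is a function of which only the values on \<open>I\<close> are
  meaningful, and similarly for matrices: products sum over the inner index set, which is passed
  explicitly, and equations between vectors are only required on \<open>I\<close>.\<close>

type_synonym 'i cvec = "'i \<Rightarrow> complex"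
type_synonym ('i, 'j) cmat = "'i \<Rightarrow> 'j \<Rightarrow> complex"

definition delta :: "'i \<Rightarrow> 'i \<Rightarrow> complex" where
  "delta i j = (if i = j then 1 else 0)"

definition conj_transpose :: "('i, 'j) cmat \<Rightarrow> ('j, 'i) cmat" where
  "conj_transpose M = (\<lambda>j i. cnj (M i j))"

definition mat_mult :: "'j set \<Rightarrow> ('i, 'j) cmat \<Rightarrow> ('j, 'k) cmat \<Rightarrow> ('i, 'k) cmat" where
  "mat_mult J M N = (\<lambda>i k. \<Sum>j\<in>J. M i j * N j k)"

definition mat_vec :: "'j set \<Rightarrow> ('i, 'j) cmat \<Rightarrow> 'j cvec \<Rightarrow> 'i cvec" where
  "mat_vec J M v = (\<lambda>i. \<Sum>j\<in>J. M i j * v j)"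

primrec mat_power :: "'i set \<Rightarrow> ('i, 'i) cmat \<Rightarrow> nat \<Rightarrow> ('i, 'i) cmat" where
  "mat_power I M 0 = delta"
| "mat_power I M (Suc n) = mat_mult I M (mat_power I M n)"

definition vec_norm :: "'i set \<Rightarrow> 'i cvec \<Rightarrow> real" where
  "vec_norm I v = sqrt (\<Sum>i\<in>I. (cmod (v i))\<^sup>2)"


section \<open>Grover walk and perfect state transfer\<close>

definition boundary :: "'v graph \<Rightarrow> ('v, 'v \<times> 'v) cmat" where
  "boundary G = (\<lambda>x a. complex_of_real (1 / sqrt (real (degree G x))) * delta x (terminus a))"

definition shift :: "('v \<times> 'v, 'v \<times> 'v) cmat" where
  "shift = (\<lambda>a b. delta a (inv_arc b))"

definition grover :: "'v graph \<Rightarrow> ('v \<times> 'v, 'v \<times> 'v) cmat" where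
  "grover G = mat_mult (arcs G) shift
     (\<lambda>a b. 2 * mat_mult (verts G) (conj_transpose (boundary G)) (boundary G) a b - delta a b)"

definition is_state :: "'v graph \<Rightarrow> ('v \<times> 'v) cvec \<Rightarrow> bool" where
  "is_state G \<Phi> \<longleftrightarrow> vec_norm (arcs G) \<Phi> = 1"

text \<open>The vector \<open>d\<^sup>* e\<^sub>x\<close>; here \<open>delta x\<close> is the unit vector \<open>e\<^sub>x\<close>.\<close>

definition vertex_state :: "'v graph \<Rightarrow> 'v \<Rightarrow> ('v \<times> 'v) cvec" where
  "vertex_state G x = mat_vec (verts G) (conj_transpose (boundary G)) (delta x)"

definition pst :: "'v graph \<Rightarrow> ('v \<times> 'v) cvec \<Rightarrow> ('v \<times> 'v) cvec \<Rightarrow> nat \<Rightarrow> bool" where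
  "pst G \<Phi> \<Psi> \<tau> \<longleftrightarrow> is_state G \<Phi> \<and> is_state G \<Psi> \<and>
     (\<exists>\<gamma>. cmod \<gamma> = 1 \<and>
        (\<forall>a \<in> arcs G. mat_vec (arcs G) (mat_power (arcs G) (grover G) \<tau>) \<Phi> a = \<gamma> * \<Psi> a))"


section \<open>Balanced complete multipartite graphs\<close>

text \<open>The vertex \<open>v\<^sub>k\<^sup>(\<^sup>j\<^sup>)\<close>, i.e. the \<open>k\<close>-th vertex of the \<open>j\<close>-th partite set, is the pair
  \<open>(j, k)\<close>.\<close>

definition partite_set :: "nat \<Rightarrow> nat \<Rightarrow> (nat \<times> nat) set" where
  "partite_set m j = {(j, k) | k. k \<in> {1..m}}"

definition multipartite :: "nat \<Rightarrow> nat \<Rightarrow> (nat \<times> nat) graph" where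
  "multipartite r m =
     (\<Union>j\<in>{1..r}. partite_set m j,
      {{x, y} | x y. \<exists>i\<in>{1..r}. \<exists>j\<in>{1..r}. x \<in> partite_set m i \<and> y \<in> partite_set m j \<and> i \<noteq> j})"

lemma fin_simple_connected_multipartite:
  assumes "r \<ge> 2" "m \<ge> 2"
  shows "fin_simple_connected (multipartite r m)"
proof -
  let ?G = "multipartite r m"
  have V: "verts ?G = {1..r} \<times> {1..m}"
    by (auto simp: verts_def multipartite_def partite_set_def)
  have A: "((i, k), (j, l)) \<in> arcs ?G"
    if "i \<in> {1..r}" "j \<in> {1..r}" "k \<in> {1..m}" "l \<in> {1..m}" "i \<noteq> j" for i j k l
    using that by (fastforce simp: arcs_def edges_def multipartite_def partite_set_def)
  have "\<exists>x \<in> verts ?G. \<exists>y \<in> verts ?G. x \<noteq> y \<and> e = {x, y}" if "e \<in> edges ?G" for e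
    using that unfolding V by (fastforce simp: edges_def multipartite_def partite_set_def)
  moreover have "(x, y) \<in> (arcs ?G)\<^sup>*" if xy: "x \<in> verts ?G" "y \<in> verts ?G" for x y
  proof -
    obtain i k j l where [simp]: "x = (i, k)" "y = (j, l)" by (cases x, cases y)
    have in_range: "i \<in> {1..r}" "j \<in> {1..r}" "k \<in> {1..m}" "l \<in> {1..m}" using xy V by auto
    show ?thesis
    proof (cases "i = j")
      case False
      then show ?thesis using A in_range by auto
    next
      case True
      define h where "h = (if i = 1 then 2 else 1 :: nat)"
      have h: "h \<in> {1..r}" "h \<noteq> i" using assms by (auto simp: h_def)
      have "(x, (h, 1)) \<in> arcs ?G" "((h, 1), y) \<in> arcs ?G"
        using A[of i h k 1] A[of h j 1 l] h in_range assms True by auto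
      then show ?thesis by (meson converse_rtrancl_into_rtrancl r_into_rtrancl)
    qed
  qed
  ultimately show ?thesis
    using assms by (auto simp: fin_simple_connected_def V)
qed

end

theory Submission
  imports Defs "HOL-Number_Theory.Cong"
begin

text \<open>
  On a \<open>k\<close>-regular graph let \<open>P = d S d\<^sup>*\<close>, which is the adjacency matrix divided by \<open>k\<close>.
  Because \<open>d d\<^sup>* = I\<close> and \<open>S\<^sup>2 = I\<close>, the span of the vectors \<open>d\<^sup>* f\<close> and \<open>S d\<^sup>* f\<close> is invariant
  under \<open>U\<close>, and on it \<open>U\<close> follows the Chebyshev recursion: \<open>U\<^sup>n d\<^sup>* f = S d\<^sup>* g\<^sub>n - d\<^sup>* g\<^sub>n\<^sub>-\<^sub>1\<close> with
  \<open>g\<^sub>0 = 0\<close>, \<open>g\<^sub>1 = f\<close> and \<open>g\<^sub>n\<^sub>+\<^sub>1 = 2 P g\<^sub>n - g\<^sub>n\<^sub>-\<^sub>1\<close> (\<open>grover_power_vertex_state\<close>). Applying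
  \<open>d\<close> gives \<open>d U\<^sup>n d\<^sup>* = T\<^sub>n(P)\<close>, where \<open>T\<^sub>n\<close> is the Chebyshev polynomial of the first kind. Hence
  transfer from \<open>x\<close> to \<open>y\<close> at time \<open>n\<close> with phase \<open>\<gamma>\<close> means \<open>T\<^sub>n(P) e\<^sub>x = \<gamma> e\<^sub>y\<close>, and pairing with
  an eigenfunction \<open>\<phi>\<close> of \<open>P\<close> for the eigenvalue \<open>c\<close> gives \<open>T\<^sub>n(c) \<phi>(x) = \<gamma> \<phi>(y)\<close>
  (\<open>pst_eigenfunctions\<close>).

  On \<open>\<Gamma>\<^sub>r\<^sub>,\<^sub>m\<close> three eigenfunctions decide everything (\<open>pst_imp\<close>). The constant function, with
  eigenvalue \<open>1\<close>, gives \<open>\<gamma> = 1\<close>. Differences of unit vectors inside one part, with eigenvalue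
  \<open>0\<close>, force \<open>y\<close> into the part of \<open>x\<close>, and if \<open>y \<noteq> x\<close> they force \<open>m = 2\<close> and \<open>T\<^sub>n(0) = -1\<close>. The
  function \<open>r 1\<^sub>V - 1\<close>, where \<open>V\<close> is the part of \<open>x\<close>, has eigenvalue \<open>-1/(r-1)\<close> and gives
  \<open>T\<^sub>n(-1/(r-1)) = 1\<close>.

  Writing \<open>-1/(r-1) = cos \<theta>\<close>, the last equation makes \<open>\<theta>\<close> a rational multiple of \<open>\<pi>\<close>, so that
  \<open>2 cos \<theta>\<close> is a rational algebraic integer and \<open>r - 1\<close> divides \<open>2\<close>. The elementary form of
  this argument is a congruence for the numerators of \<open>2 T\<^sub>n\<close> at rational points
  (\<open>chebyshev_rational\<close>). For \<open>r = 2\<close> and \<open>n \<le> 3\<close> the condition \<open>T\<^sub>n(0) = -1\<close> leaves only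
  \<open>n = 2\<close>; for \<open>r = 3\<close> and \<open>n \<le> 11\<close> it leaves \<open>2, 6, 10\<close>, of which \<open>T\<^sub>n(-1/2) = 1\<close> selects \<open>6\<close>. That
  transfer does happen at these two times is seen by computing the functions \<open>g\<^sub>n\<close> on
  \<open>\<Gamma>\<^sub>2\<^sub>,\<^sub>2\<close> and \<open>\<Gamma>\<^sub>3\<^sub>,\<^sub>2\<close>.
\<close>

section \<open>Chebyshev polynomials\<close>

fun chebyshev :: "nat \<Rightarrow> 'a::comm_ring_1 \<Rightarrow> 'a" where
  "chebyshev 0 x = 1"
| "chebyshev (Suc 0) x = x"
| "chebyshev (Suc (Suc n)) x = 2 * x * chebyshev (Suc n) x - chebyshev n x"

lemma chebyshev_one: "chebyshev n (1::'a::comm_ring_1) = 1"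
  by (induction n "1::'a" rule: chebyshev.induct) auto

text \<open>With \<open>x = p/(2q)\<close> the integers \<open>A\<^sub>n = 2 T\<^sub>n(x) q\<^sup>n\<close> satisfy
  \<open>A\<^sub>n\<^sub>+\<^sub>2 = p A\<^sub>n\<^sub>+\<^sub>1 - q\<^sup>2 A\<^sub>n\<close>, and modulo \<open>q\<close> the second summand drops out. The two
  consecutive indices carry the induction; the congruence starts only at index \<open>1\<close> because
  \<open>A\<^sub>0 = 2\<close>.\<close>

lemma chebyshev_rational:
  fixes p q :: int
  assumes "q \<noteq> 0"
  shows "\<exists>a b. 2 * chebyshev n (of_int p / (2 * of_int q) :: 'a::field_char_0) * of_int q ^ n = of_int b \<and>
    2 * chebyshev (Suc n) (of_int p / (2 * of_int q) :: 'a) * of_int q ^ Suc n = of_int a \<and>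
    [a = p ^ Suc n] (mod q)"
proof (induction n)
  case 0
  then show ?case
    using assms by (intro exI[of _ p] exI[of _ 2]) simp
next
  case (Suc n)
  let ?x = "of_int p / (2 * of_int q) :: 'a"
  obtain a b where b: "2 * chebyshev n ?x * of_int q ^ n = of_int b"
    and a: "2 * chebyshev (Suc n) ?x * of_int q ^ Suc n = of_int a"
    and c: "[a = p ^ Suc n] (mod q)" using Suc by blast
  have px: "of_int p = ?x * (2 * of_int q)" using assms by simp
  have rec: "P * (2 * t' * Q ^ Suc n) - Q\<^sup>2 * (2 * t * Q ^ n) = 2 * (2 * x * t' - t) * Q ^ Suc (Suc n)"
    if "P = x * (2 * Q)" for P Q t t' x :: 'a
    using that by (simp add: algebra_simps power2_eq_square)
  have "of_int (p * a - q^2 * b) = of_int p * of_int a - of_int q ^ 2 * (of_int b :: 'a)" by simp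
  also have "\<dots> = 2 * chebyshev (Suc (Suc n)) ?x * of_int q ^ Suc (Suc n)"
    unfolding a[symmetric] b[symmetric] chebyshev.simps by (rule rec[OF px])
  finally have e: "2 * chebyshev (Suc (Suc n)) ?x * of_int q ^ Suc (Suc n) = of_int (p * a - q^2 * b)" ..
  have "[p * a - q^2 * b = p * p ^ Suc n - 0] (mod q)"
    by (intro cong_diff cong_mult c) (simp_all add: cong_0_iff power2_eq_square)
  then have f: "[p * a - q^2 * b = p ^ Suc (Suc n)] (mod q)" by simp
  show ?case
    using a e f by blast
qed

text \<open>The numerator \<open>2 q\<^sup>n\<close> of the value \<open>1\<close> is divisible by \<open>q\<close> but congruent to \<open>p\<^sup>n\<close>, which is
  coprime to \<open>q\<close>.\<close>

lemma chebyshev_rational_eq_1: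
  fixes p q :: int
  assumes "coprime p q" "q \<noteq> 0" "n \<ge> 1"
    and "chebyshev n (of_int p / (2 * of_int q) :: 'a::field_char_0) = 1"
  shows "is_unit q"
proof -
  obtain k where n: "n = Suc k" using assms(3) by (cases n) auto
  obtain a where a: "2 * chebyshev n (of_int p / (2 * of_int q) :: 'a) * of_int q ^ n = of_int a"
    "[a = p ^ n] (mod q)"
    using chebyshev_rational[OF assms(2), where 'a = 'a and n = k and p = p] unfolding n by auto
  have "(of_int a :: 'a) = of_int (2 * q ^ n)" using a(1) unfolding assms(4) by simp
  then have "a = 2 * q ^ n" by (simp only: of_int_eq_iff)
  then have "q dvd a" using n by simp
  then have "q dvd p ^ n" using a(2) by (simp add: cong_def dvd_eq_mod_eq_0)
  moreover have "coprime (p ^ n) q" using assms(1) by simp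
  ultimately show ?thesis by (simp only: coprime_common_divisor[of "p ^ n" q q] dvd_refl)
qed

lemma chebyshev_neg_inverse_eq_1:
  fixes N :: nat
  assumes "N \<ge> 1" "n \<ge> 1" "chebyshev n (- 1 / of_nat N :: 'a::field_char_0) = 1"
  shows "N \<in> {1, 2}"
proof -
  \<comment> \<open>The fraction \<open>p/q\<close> is \<open>-2/N\<close> in lowest terms.\<close>
  define g where "g = gcd (-2) (int N)"
  define p q where "p = -2 div g" and "q = int N div g"
  have g: "g dvd -2" "g dvd int N" unfolding g_def by (rule gcd_dvd1, rule gcd_dvd2)
  then have 1: "p * g = -2" "q * g = int N"
    by (simp_all add: p_def q_def)
  have "coprime p q"
    unfolding p_def q_def g_def by (rule div_gcd_coprime) simp
  have q0: "q \<noteq> 0" using 1 assms by auto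
  have "(- 1 / of_nat N :: 'a) = of_int p / (2 * of_int q)"
  proof -
    have "p * int N = -2 * q" unfolding 1[symmetric] by (simp only: ac_simps)
    then have "(of_int (p * int N) :: 'a) = of_int (-2 * q)" by (simp only:)
    then have "of_int p * of_nat N = -2 * (of_int q :: 'a)" by simp
    moreover have "of_int q \<noteq> (0 :: 'a)" "of_nat N \<noteq> (0 :: 'a)" using q0 assms(1) by auto
    ultimately show ?thesis by (subst frac_eq_eq) (simp_all add: mult.commute)
  qed
  then have cheb: "chebyshev n (of_int p / (2 * of_int q) :: 'a) = 1" using assms(3) by (simp only:)
  have "is_unit q"
    using \<open>coprime p q\<close> q0 assms(2) cheb by (rule chebyshev_rational_eq_1)
  then have "int N dvd -2" using g(1) unfolding 1(2)[symmetric] by (simp only: mult_unit_dvd_iff')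
  then have "int N \<le> 2" using zdvd_imp_le[of "int N" 2] by simp
  then show ?thesis using assms(1) by auto
qed

section \<open>The Grover walk on a regular graph\<close>

lemma mat_vec_mat_power_0: "finite I \<Longrightarrow> i \<in> I \<Longrightarrow> mat_vec I (mat_power I M 0) v i = v i"
  by (simp add: mat_vec_def delta_def if_distrib[of "\<lambda>c. c * _"] cong: if_cong)

lemma mat_vec_mat_power_Suc:
  "mat_vec I (mat_power I M (Suc n)) v = mat_vec I M (mat_vec I (mat_power I M n) v)"
proof
  fix i
  have "mat_vec I (mat_power I M (Suc n)) v i = (\<Sum>j\<in>I. \<Sum>l\<in>I. M i l * mat_power I M n l j * v j)"
    by (simp add: mat_vec_def mat_mult_def sum_distrib_right)
  also have "\<dots> = (\<Sum>l\<in>I. \<Sum>j\<in>I. M i l * mat_power I M n l j * v j)"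
    by (rule sum.swap)
  also have "\<dots> = mat_vec I M (mat_vec I (mat_power I M n) v) i"
    by (simp add: mat_vec_def sum_distrib_left mult.assoc)
  finally show "mat_vec I (mat_power I M (Suc n)) v i = mat_vec I M (mat_vec I (mat_power I M n) v) i" .
qed

locale regular_graph =
  fixes G :: "'v graph" and k :: nat
  assumes fin_simple_connected: "fin_simple_connected G"
    and degree: "x \<in> verts G \<Longrightarrow> degree G x = k"
    and k_pos: "k > 0"
begin

definition nbrs :: "'v \<Rightarrow> 'v set" where
  "nbrs x = {y. (x, y) \<in> arcs G}"

lemma finite_verts: "finite (verts G)"
  using fin_simple_connected by (simp add: fin_simple_connected_def)

lemma edge_ends: "e \<in> edges G \<Longrightarrow> \<exists>u \<in> verts G. \<exists>v \<in> verts G. u \<noteq> v \<and> e = {u, v}"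
  using fin_simple_connected by (simp add: fin_simple_connected_def)

lemma arcs_sym: "(x, y) \<in> arcs G \<longleftrightarrow> (y, x) \<in> arcs G"
  by (simp add: arcs_def insert_commute[of x y])

lemma nbrs_sym: "y \<in> nbrs x \<longleftrightarrow> x \<in> nbrs y"
  using arcs_sym[of x y] by (simp add: nbrs_def)

lemma nbrs_iff: "z \<in> nbrs x \<longleftrightarrow> (z, x) \<in> arcs G"
  using arcs_sym[of z x] by (simp add: nbrs_def)

lemma arcs_verts:
  assumes "(x, y) \<in> arcs G" shows "x \<in> verts G" "y \<in> verts G" "x \<noteq> y"
proof -
  have "\<exists>u \<in> verts G. \<exists>v \<in> verts G. u \<noteq> v \<and> {x, y} = {u, v}"
    using assms by (intro edge_ends) (simp add: arcs_def)
  then obtain u v where "u \<in> verts G" "v \<in> verts G" "u \<noteq> v" "{x, y} = {u, v}" by auto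
  then show "x \<in> verts G" "y \<in> verts G" "x \<noteq> y" by (auto simp: doubleton_eq_iff)
qed

lemma nbrs_subset: "nbrs x \<subseteq> verts G"
  using arcs_verts by (auto simp: nbrs_def)

lemma finite_arcs: "finite (arcs G)"
proof (rule finite_subset)
  show "arcs G \<subseteq> verts G \<times> verts G" using arcs_verts by auto
qed (simp add: finite_verts)

lemma card_nbrs:
  assumes "x \<in> verts G" shows "card (nbrs x) = k"
proof -
  have "bij_betw (\<lambda>y. {x, y}) (nbrs x) {e \<in> edges G. x \<in> e}"
  proof (intro bij_betwI')
    fix e assume e: "e \<in> {e \<in> edges G. x \<in> e}"
    then obtain u v where "e = {u, v}"
      using edge_ends[of e] by auto
    then have "e = {x, u} \<or> e = {x, v}" using e by auto
    then show "\<exists>y\<in>nbrs x. e = {x, y}" using e by (auto simp: nbrs_def arcs_def)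
  qed (auto simp: nbrs_def arcs_def doubleton_eq_iff)
  then show ?thesis using degree[OF assms] by (simp add: degree_def bij_betw_same_card)
qed

lemma vertex_state_apply:
  assumes "x \<in> verts G" "(u, v) \<in> arcs G"
  shows "vertex_state G x (u, v) = (if v = x then 1 / sqrt k else 0)"
proof -
  have "vertex_state G x (u, v) = (\<Sum>z\<in>verts G. if z = x then (if v = x then complex_of_real (1 / sqrt k) else 0) else 0)"
    unfolding vertex_state_def mat_vec_def conj_transpose_def boundary_def
    by (rule sum.cong) (auto simp: delta_def terminus_def degree)
  then show ?thesis using assms finite_verts by simp
qed

lemma sum_arcs_into:
  assumes "x \<in> verts G"
  shows "(\<Sum>a\<in>arcs G. if snd a = x then F a else 0) = (\<Sum>z\<in>nbrs x. F (z, x))"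
proof -
  have "(\<Sum>a\<in>arcs G. if snd a = x then F a else 0) = (\<Sum>a\<in>{a\<in>arcs G. snd a = x}. F a)"
    by (simp add: sum.inter_filter finite_arcs)
  also have "{a\<in>arcs G. snd a = x} = (\<lambda>z. (z, x)) ` nbrs x"
    by (auto simp: nbrs_iff)
  also have "sum F \<dots> = (\<Sum>z\<in>nbrs x. F (z, x))"
    by (subst sum.reindex) (auto simp: inj_on_def)
  finally show ?thesis .
qed

lemma is_state_vertex_state:
  assumes "x \<in> verts G" shows "is_state G (vertex_state G x)"
proof -
  have "(\<Sum>a\<in>arcs G. (cmod (vertex_state G x a))\<^sup>2) = (\<Sum>a\<in>arcs G. if snd a = x then 1 / k else 0)"
  proof (rule sum.cong)
    fix a assume "a \<in> arcs G"
    then have "vertex_state G x a = (if snd a = x then complex_of_real (1 / sqrt k) else 0)"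
      using vertex_state_apply[OF assms, of "fst a" "snd a"] by simp
    then show "(cmod (vertex_state G x a))\<^sup>2 = (if snd a = x then 1 / k else 0)"
      by (simp add: norm_divide power_divide)
  qed simp
  also have "\<dots> = 1"
    unfolding sum_arcs_into[OF assms] using k_pos card_nbrs[OF assms] by simp
  finally show ?thesis by (simp add: is_state_def vec_norm_def)
qed

text \<open>The factor \<open>2 d\<^sup>* d\<close> replaces the value on an arc by twice the average over all arcs with the
  same terminus, and the shift then reverses the arc.\<close>

lemma grover_apply:
  fixes \<Psi> :: "'v \<times> 'v \<Rightarrow> complex"
  assumes "(x, y) \<in> arcs G"
  shows "mat_vec (arcs G) (grover G) \<Psi> (x, y) =
    2 / of_nat k * (\<Sum>z\<in>nbrs x. \<Psi> (z, x)) - \<Psi> (y, x)"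
proof -
  note xy = arcs_verts[OF assms]
  have yx: "(y, x) \<in> arcs G" using assms arcs_sym by blast
  have kk: "complex_of_real (1 / sqrt k) * complex_of_real (1 / sqrt k) = 1 / of_nat k"
    unfolding of_real_mult[symmetric] by simp
  have dd: "mat_mult (verts G) (conj_transpose (boundary G)) (boundary G) (y, x) b =
      (if snd b = x then 1 / of_nat k else 0)" if "b \<in> arcs G" for b
  proof -
    have "mat_mult (verts G) (conj_transpose (boundary G)) (boundary G) (y, x) b =
        (\<Sum>z\<in>verts G. if z = x then (if snd b = x then 1 / of_nat k else 0) else 0)"
      unfolding mat_mult_def conj_transpose_def boundary_def
      by (rule sum.cong)
        (auto simp: delta_def terminus_def degree kk simp del: of_real_divide)
    then show ?thesis using xy finite_verts by simp
  qed
  have entry: "grover G (x, y) b = 2 * (if snd b = x then 1 / of_nat k else 0) - delta (y, x) b"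
    if b: "b \<in> arcs G" for b
  proof -
    have "grover G (x, y) b = (\<Sum>c\<in>arcs G. if c = (y, x) then
       2 * mat_mult (verts G) (conj_transpose (boundary G)) (boundary G) (y, x) b - delta (y, x) b else 0)"
      unfolding grover_def mat_mult_def[of "arcs G"] shift_def
      by (rule sum.cong) (auto simp: delta_def inv_arc_def)
    then show ?thesis using yx finite_arcs dd[OF b] by simp
  qed
  have "mat_vec (arcs G) (grover G) \<Psi> (x, y) =
    (\<Sum>b\<in>arcs G. (if snd b = x then 2 / of_nat k * \<Psi> b else 0) - (if b = (y, x) then \<Psi> b else 0))"
    unfolding mat_vec_def
    by (intro sum.cong refl) (auto simp: entry delta_def left_diff_distrib)
  also have "\<dots> = 2 / of_nat k * (\<Sum>z\<in>nbrs x. \<Psi> (z, x)) - \<Psi> (y, x)"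
    using yx finite_arcs
    by (simp add: sum_subtractf sum_arcs_into[OF xy(1)] sum_distrib_left)
  finally show ?thesis .
qed

text \<open>This is the operator \<open>P = d S d\<^sup>*\<close>.\<close>

definition nbr_avg :: "('v \<Rightarrow> complex) \<Rightarrow> 'v \<Rightarrow> complex" where
  "nbr_avg f x = (\<Sum>y\<in>nbrs x. f y) / k"

lemma nbr_avg_diff: "nbr_avg (\<lambda>w. f w - g w) z = nbr_avg f z - nbr_avg g z"
  by (simp add: nbr_avg_def sum_subtractf diff_divide_distrib)

lemma nbr_avg_cong:
  assumes "\<And>w. w \<in> verts G \<Longrightarrow> f w = g w"
  shows "nbr_avg f z = nbr_avg g z"
  unfolding nbr_avg_def using assms nbrs_subset
  by (intro arg_cong2[where f = "(/)"] sum.cong refl) auto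

lemma nbr_avg_self_adjoint:
  "(\<Sum>x\<in>verts G. \<phi> x * nbr_avg f x) = (\<Sum>x\<in>verts G. nbr_avg \<phi> x * f x)"
proof -
  have nb: "nbr_avg f x = (\<Sum>y\<in>verts G. if y \<in> nbrs x then f y / k else 0)" for f x
    using nbrs_subset by (simp add: nbr_avg_def sum_divide_distrib sum.inter_restrict[symmetric]
       finite_verts Int_absorb1)
  have "(\<Sum>x\<in>verts G. \<phi> x * nbr_avg f x) =
     (\<Sum>x\<in>verts G. \<Sum>y\<in>verts G. if y \<in> nbrs x then \<phi> x * f y / k else 0)"
    unfolding nb by (auto simp: sum_distrib_left intro!: sum.cong)
  also have "\<dots> = (\<Sum>y\<in>verts G. \<Sum>x\<in>verts G. if y \<in> nbrs x then \<phi> x * f y / k else 0)"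
    by (rule sum.swap)
  also have "\<dots> = (\<Sum>x\<in>verts G. nbr_avg \<phi> x * f x)"
    unfolding nb by (auto simp: sum_distrib_right nbrs_sym intro!: sum.cong)
  finally show ?thesis .
qed

text \<open>The function \<open>wave f n\<close> is \<open>R\<^sub>n\<^sub>-\<^sub>1(P) f\<close> for the Chebyshev polynomials \<open>R\<^sub>0, R\<^sub>1, \<dots>\<close> of the
  second kind; starting one step earlier, at \<open>R\<^sub>-\<^sub>1 = 0\<close>, lets the first step of the walk have
  the same form as the later ones.\<close>

fun wave :: "('v \<Rightarrow> complex) \<Rightarrow> nat \<Rightarrow> 'v \<Rightarrow> complex" where
  "wave f 0 = (\<lambda>x. 0)"
| "wave f (Suc 0) = f"
| "wave f (Suc (Suc n)) = (\<lambda>x. 2 * nbr_avg (wave f (Suc n)) x - wave f n x)"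

text \<open>On the arc \<open>(u, v)\<close> the vector \<open>S d\<^sup>* g\<close> has the value \<open>g u / \<surd>k\<close> and \<open>d\<^sup>* h\<close> has the value
  \<open>h v / \<surd>k\<close>. So the formula says \<open>U\<^sup>n\<^sup>+\<^sup>1 d\<^sup>* e\<^sub>x = S d\<^sup>* g\<^sub>n\<^sub>+\<^sub>1 - d\<^sup>* g\<^sub>n\<close>, and it propagates by
  \<open>U d\<^sup>* h = S d\<^sup>* h\<close> and \<open>U S d\<^sup>* g = 2 S d\<^sup>* P g - d\<^sup>* g\<close>.\<close>

lemma grover_power_vertex_state:
  assumes "x \<in> verts G" "(u, v) \<in> arcs G"
  shows "mat_vec (arcs G) (mat_power (arcs G) (grover G) (Suc n)) (vertex_state G x) (u, v) =
    (wave (delta x) (Suc n) u - wave (delta x) n v) / sqrt k"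
  using assms(2)
proof (induction n arbitrary: u v)
  case 0
  note uv = arcs_verts[OF 0]
  have nb: "z \<in> nbrs u \<Longrightarrow> (z, u) \<in> arcs G" for z
    by (simp add: nbrs_iff)
  have vu: "(v, u) \<in> arcs G" using 0 arcs_sym by blast
  have "mat_vec (arcs G) (mat_power (arcs G) (grover G) 0) (vertex_state G x) (z, u) =
     delta x u / sqrt k" if "(z, u) \<in> arcs G" for z
    using that by (simp only: mat_vec_mat_power_0 finite_arcs) (simp add: vertex_state_apply assms(1) delta_def)
  then have "mat_vec (arcs G) (mat_power (arcs G) (grover G) (Suc 0)) (vertex_state G x) (u, v) =
     2 / of_nat k * (\<Sum>z\<in>nbrs u. delta x u / sqrt k) - delta x u / sqrt k"
    unfolding mat_vec_mat_power_Suc grover_apply[OF 0] using vu nb by (simp only: cong: sum.cong)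
  also have "\<dots> = delta x u / sqrt k"
    using k_pos by (simp add: card_nbrs[OF uv(1)])
  finally show ?case by simp
next
  case (Suc n)
  note uv = arcs_verts[OF Suc.prems]
  let ?g = "wave (delta x)"
  have nb: "z \<in> nbrs u \<Longrightarrow> (z, u) \<in> arcs G" for z
    by (simp add: nbrs_iff)
  have vu: "(v, u) \<in> arcs G" using Suc.prems arcs_sym by blast
  have "mat_vec (arcs G) (mat_power (arcs G) (grover G) (Suc (Suc n))) (vertex_state G x) (u, v) =
     2 / of_nat k * (\<Sum>z\<in>nbrs u. (?g (Suc n) z - ?g n u) / sqrt k) - (?g (Suc n) v - ?g n u) / sqrt k"
    unfolding mat_vec_mat_power_Suc[of _ _ "Suc n"] grover_apply[OF Suc.prems]
    using vu nb by (simp only: Suc.IH cong: sum.cong)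
  also have "(\<Sum>z\<in>nbrs u. (?g (Suc n) z - ?g n u) / sqrt k) =
     (k * nbr_avg (?g (Suc n)) u - k * ?g n u) / sqrt k"
    using k_pos
    by (simp add: sum_divide_distrib[symmetric] sum_subtractf card_nbrs[OF uv(1)] nbr_avg_def)
  also have "2 / of_nat k * ((k * nbr_avg (?g (Suc n)) u - k * ?g n u) / sqrt k) - (?g (Suc n) v - ?g n u) / sqrt k =
     (?g (Suc (Suc n)) u - ?g (Suc n) v) / sqrt k"
    using k_pos by (simp add: field_simps)
  finally show ?case .
qed

lemma pst_vertex_states_iff:
  assumes "x \<in> verts G" "y \<in> verts G"
  shows "pst G (vertex_state G x) (vertex_state G y) (Suc n) \<longleftrightarrow>
    (\<exists>\<gamma>. cmod \<gamma> = 1 \<and> (\<forall>(u, v)\<in>arcs G.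
       wave (delta x) (Suc n) u - wave (delta x) n v = \<gamma> * delta y v))"
proof -
  have "(mat_vec (arcs G) (mat_power (arcs G) (grover G) (Suc n)) (vertex_state G x) (u, v) =
      \<gamma> * vertex_state G y (u, v)) \<longleftrightarrow>
     wave (delta x) (Suc n) u - wave (delta x) n v = \<gamma> * delta y v"
    if "(u, v) \<in> arcs G" for u v \<gamma>
    unfolding grover_power_vertex_state[OF assms(1) that] vertex_state_apply[OF assms(2) that]
    using k_pos by (auto simp: delta_def field_simps)
  then have "(\<forall>a\<in>arcs G. mat_vec (arcs G) (mat_power (arcs G) (grover G) (Suc n)) (vertex_state G x) a =
      \<gamma> * vertex_state G y a) \<longleftrightarrow>
     (\<forall>(u, v)\<in>arcs G. wave (delta x) (Suc n) u - wave (delta x) n v = \<gamma> * delta y v)" for \<gamma>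
    by (intro ball_cong refl) (simp add: split_paired_all del: mat_power.simps)
  then show ?thesis
    by (simp only: pst_def is_state_vertex_state assms simp_thms)
qed

text \<open>This rests on the relation \<open>x R\<^sub>n(x) - R\<^sub>n\<^sub>-\<^sub>1(x) = T\<^sub>n\<^sub>+\<^sub>1(x)\<close> between the Chebyshev polynomials
  \<open>R\<^sub>n\<close> of the second and \<open>T\<^sub>n\<close> of the first kind. Since \<open>P\<close> is self-adjoint, pairing with an
  eigenfunction turns \<open>P\<close> into its eigenvalue.\<close>

lemma inner_wave:
  assumes "\<And>z. z \<in> verts G \<Longrightarrow> nbr_avg \<phi> z = c * \<phi> z"
  shows "(\<Sum>z\<in>verts G. \<phi> z * (nbr_avg (wave f (Suc n)) z - wave f n z)) =
    chebyshev (Suc n) c * (\<Sum>z\<in>verts G. \<phi> z * f z)"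
proof -
  define s where "s n = (\<Sum>z\<in>verts G. \<phi> z * wave f n z)" for n
  have avg: "(\<Sum>z\<in>verts G. \<phi> z * nbr_avg h z) = c * (\<Sum>z\<in>verts G. \<phi> z * h z)" for h
    by (simp add: nbr_avg_self_adjoint assms sum_distrib_left mult.assoc)
  have s: "s 0 = 0" "s (Suc (Suc n)) = 2 * c * s (Suc n) - s n" for n
  proof -
    have "s (Suc (Suc n)) = 2 * (\<Sum>z\<in>verts G. \<phi> z * nbr_avg (wave f (Suc n)) z) - s n"
      by (simp add: s_def right_diff_distrib sum_subtractf sum_distrib_left algebra_simps)
    then show "s (Suc (Suc n)) = 2 * c * s (Suc n) - s n"
      unfolding avg by (simp add: s_def)
  qed (simp add: s_def)
  have "c * s (Suc n) - s n = chebyshev (Suc n) c * s 1 \<and>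
     c * s (Suc (Suc n)) - s (Suc n) = chebyshev (Suc (Suc n)) c * s 1"
  proof (induction n)
    case 0
    show ?case by (simp add: s algebra_simps)
  next
    case (Suc n)
    have "c * s (Suc (Suc (Suc n))) - s (Suc (Suc n)) =
      2 * c * (c * s (Suc (Suc n)) - s (Suc n)) - (c * s (Suc n) - s n)"
      unfolding s(2)[of "Suc n"] using s(2)[of n] by (simp add: algebra_simps)
    also have "\<dots> = 2 * c * (chebyshev (Suc (Suc n)) c * s 1) - chebyshev (Suc n) c * s 1"
      using Suc by (simp only:)
    also have "\<dots> = chebyshev (Suc (Suc (Suc n))) c * s 1"
      by (simp add: algebra_simps)
    finally show ?case using Suc by blast
  qed
  then have "c * s (Suc n) - s n = chebyshev (Suc n) c * s 1" by blast
  then show ?thesis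
    by (simp add: right_diff_distrib sum_subtractf avg s_def)
qed

text \<open>One phase \<open>\<gamma>\<close> serves all eigenfunctions. The condition on arcs becomes the condition
  \<open>T\<^sub>n(P) e\<^sub>x = \<gamma> e\<^sub>y\<close> on vertices by averaging it over the arcs that end in a given vertex,
  that is, by applying \<open>d\<close>.\<close>

theorem pst_eigenfunctions:
  assumes "x \<in> verts G" "y \<in> verts G" "n \<ge> 1"
    and "pst G (vertex_state G x) (vertex_state G y) n"
  obtains \<gamma> where "cmod \<gamma> = 1"
    and "\<And>\<phi> c. (\<And>z. z \<in> verts G \<Longrightarrow> nbr_avg \<phi> z = c * \<phi> z) \<Longrightarrow> chebyshev n c * \<phi> x = \<gamma> * \<phi> y"
proof -
  obtain l where n: "n = Suc l" using assms(3) by (cases n) auto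
  let ?g = "wave (delta x)"
  obtain \<gamma> where \<gamma>: "cmod \<gamma> = 1"
    "\<And>u v. (u, v) \<in> arcs G \<Longrightarrow> ?g (Suc l) u - ?g l v = \<gamma> * delta y v"
    using assms(4) unfolding n pst_vertex_states_iff[OF assms(1,2)] by auto
  have avg: "nbr_avg (?g (Suc l)) v - ?g l v = \<gamma> * delta y v" if v: "v \<in> verts G" for v
  proof -
    have "?g (Suc l) u = ?g l v + \<gamma> * delta y v" if "u \<in> nbrs v" for u
      using \<gamma>(2)[of u v] that by (simp add: nbrs_iff algebra_simps)
    then have "nbr_avg (?g (Suc l)) v = ?g l v + \<gamma> * delta y v"
      using k_pos card_nbrs[OF v] by (simp add: nbr_avg_def)
    then show ?thesis by simp
  qed
  have pick: "(\<Sum>z\<in>verts G. \<phi> z * (a * delta w z)) = a * \<phi> w" if "w \<in> verts G" for \<phi> w a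
  proof -
    have "(\<Sum>z\<in>verts G. \<phi> z * (a * delta w z)) = (\<Sum>z\<in>verts G. if z = w then a * \<phi> w else 0)"
      by (rule sum.cong) (auto simp: delta_def)
    then show ?thesis using that finite_verts by simp
  qed
  show thesis
  proof (rule that[OF \<gamma>(1)])
    fix \<phi> c assume "\<And>z. z \<in> verts G \<Longrightarrow> nbr_avg \<phi> z = c * \<phi> z"
    from inner_wave[OF this, of "delta x" l] show "chebyshev n c * \<phi> x = \<gamma> * \<phi> y"
      using pick[OF assms(1), of \<phi> 1] pick[OF assms(2), of \<phi> \<gamma>] by (simp add: avg n cong: sum.cong)
  qed
qed

end

section \<open>Complete multipartite graphs\<close>

lemma verts_multipartite: "verts (multipartite r m) = {1..r} \<times> {1..m}"
  by (auto simp: verts_def multipartite_def partite_set_def)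

lemma arcs_multipartite:
  "(x, y) \<in> arcs (multipartite r m) \<longleftrightarrow>
     x \<in> verts (multipartite r m) \<and> y \<in> verts (multipartite r m) \<and> fst x \<noteq> fst y"
  unfolding verts_multipartite
  by (cases x; cases y)
    (auto simp: arcs_def edges_def multipartite_def partite_set_def doubleton_eq_iff)

lemma card_other_parts:
  assumes "i \<in> {1..r}"
  shows "card (({1..r} - {i}) \<times> {1..m::nat}) = (r - 1) * m"
  using assms by (simp add: card_cartesian_product)

lemma regular_graph_multipartite:
  assumes "r \<ge> 2" "m \<ge> 2"
  shows "regular_graph (multipartite r m) ((r - 1) * m)"
proof
  show "fin_simple_connected (multipartite r m)"
    using assms by (rule fin_simple_connected_multipartite)
  show "(r - 1) * m > 0" using assms by simp
  fix x assume x: "x \<in> verts (multipartite r m)"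
  have "bij_betw (\<lambda>y. {x, y}) (({1..r} - {fst x}) \<times> {1..m}) {e \<in> edges (multipartite r m). x \<in> e}"
  proof (intro bij_betwI')
    fix e assume e: "e \<in> {e \<in> edges (multipartite r m). x \<in> e}"
    then obtain u v where uv: "e = {u, v}" by (auto simp: edges_def multipartite_def)
    with e have "e = {x, u} \<or> e = {x, v}" by auto
    then have "\<exists>y. e = {x, y}" by blast
    then obtain y where y: "e = {x, y}" ..
    with e have "(x, y) \<in> arcs (multipartite r m)" by (auto simp: arcs_def)
    then show "\<exists>y\<in>({1..r} - {fst x}) \<times> {1..m}. e = {x, y}"
      using y by (intro bexI[of _ y]) (auto simp: arcs_multipartite verts_multipartite)
  next
    fix y assume "y \<in> ({1..r} - {fst x}) \<times> {1..m}"
    then have "(x, y) \<in> arcs (multipartite r m)"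
      using x by (auto simp: arcs_multipartite verts_multipartite)
    then show "{x, y} \<in> {e \<in> edges (multipartite r m). x \<in> e}" by (simp add: arcs_def)
  qed (auto simp: doubleton_eq_iff)
  then show "degree (multipartite r m) x = (r - 1) * m"
    using x card_other_parts[of "fst x" r m] bij_betw_same_card
    by (fastforce simp: degree_def verts_multipartite)
qed

text \<open>The degree \<open>k\<close> is a parameter of its own so that it can be the plain number \<open>2\<close> or \<open>4\<close> in the
  two explicit graphs below.\<close>

locale multipartite_graph =
  fixes r m k :: nat
  assumes r: "r \<ge> 2" and m: "m \<ge> 2" and k: "k = (r - 1) * m"

sublocale multipartite_graph \<subseteq> regular_graph "multipartite r m" k
  unfolding k using r m by (rule regular_graph_multipartite)

context multipartite_graph
begin

lemma nbrs_multipartite: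
  assumes "x \<in> verts (multipartite r m)"
  shows "nbrs x = ({1..r} - {fst x}) \<times> {1..m}"
  using assms unfolding nbrs_def by (auto simp: arcs_multipartite verts_multipartite)

text \<open>The functions invariant under the automorphisms that fix \<open>x\<close> are spanned by the unit vector at
  \<open>x\<close>, the indicator of the part of \<open>x\<close> and the constant \<open>1\<close>, so \<open>P\<close> preserves their span. A vertex
  in the part of \<open>x\<close> sees none of the mass \<open>a + b m\<close> of the first two; every other vertex sees all
  of it.\<close>

lemma nbr_avg_combination:
  assumes "x \<in> verts (multipartite r m)" "z \<in> verts (multipartite r m)"
  shows "nbr_avg (\<lambda>w. a * delta x w + b * delta (fst x) (fst w) + c) z =
    c + (a + b * m) / k * (1 - delta (fst x) (fst z))"
proof -
  let ?N = "({1..r} - {fst z}) \<times> {1..m}"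
  have "(\<Sum>w\<in>?N. delta x w) = (\<Sum>w\<in>?N. if w = x then 1 else 0)"
    by (rule sum.cong) (auto simp: delta_def)
  also have "\<dots> = 1 - delta (fst x) (fst z)"
    using assms by (cases x) (auto simp: delta_def verts_multipartite)
  finally have 1: "(\<Sum>w\<in>?N. delta x w) = 1 - delta (fst x) (fst z)" .
  have "(\<Sum>w\<in>?N. delta (fst x) (fst w)) = (\<Sum>j\<in>{1..r} - {fst z}. \<Sum>l\<in>{1..m}. delta (fst x) j)"
    by (simp only: sum.cartesian_product' fst_conv)
  also have "\<dots> = (\<Sum>j\<in>{1..r} - {fst z}. if j = fst x then of_nat m else 0)"
    by (rule sum.cong) (auto simp: delta_def)
  also have "\<dots> = m * (1 - delta (fst x) (fst z))"
    using assms by (cases x) (auto simp: delta_def verts_multipartite)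
  finally have 2: "(\<Sum>w\<in>?N. delta (fst x) (fst w)) = m * (1 - delta (fst x) (fst z))" .
  have 3: "card ?N = k"
    unfolding k using assms by (intro card_other_parts) (auto simp: verts_multipartite)
  have nz: "of_nat k \<noteq> (0::complex)" using k_pos by simp
  have "nbr_avg (\<lambda>w. a * delta x w + b * delta (fst x) (fst w) + c) z =
    (a * (1 - delta (fst x) (fst z)) + b * (m * (1 - delta (fst x) (fst z))) + of_nat k * c) / of_nat k"
    unfolding nbr_avg_def nbrs_multipartite[OF assms(2)]
    by (simp only: sum.distrib sum_distrib_left[symmetric] 1 2 3 sum_constant)
  then show ?thesis using nz by (simp add: field_simps)
qed

lemma part_eigenfunction:
  assumes "x \<in> verts (multipartite r m)" "z \<in> verts (multipartite r m)"
  shows "nbr_avg (\<lambda>w. r * delta (fst x) (fst w) - 1) z = (- 1 / of_nat (r - 1)) * (r * delta (fst x) (fst z) - 1)"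
proof -
  define l where "l = r - 1"
  have l: "l > 0" "r = l + 1" "k = l * m" using r k by (simp_all add: l_def)
  have "nbr_avg (\<lambda>w. r * delta (fst x) (fst w) - 1) z = - 1 + r * m / k * (1 - delta (fst x) (fst z))"
    using nbr_avg_combination[OF assms, of 0 "of_nat r" "-1"] by simp
  also have "\<dots> = (- 1 / of_nat l) * (r * delta (fst x) (fst z) - 1)"
    using l m by (simp add: field_simps)
  finally show ?thesis unfolding l_def .
qed

lemma difference_eigenfunction:
  assumes "x \<in> verts (multipartite r m)" "y \<in> verts (multipartite r m)" "fst x = fst y"
    and "z \<in> verts (multipartite r m)"
  shows "nbr_avg (\<lambda>w. delta x w - delta y w) z = 0 * (delta x z - delta y z)"
proof -
  have "nbr_avg (\<lambda>w. delta x w - delta y w) z = nbr_avg (delta x) z - nbr_avg (delta y) z"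
    by (rule nbr_avg_diff)
  then show ?thesis
    using nbr_avg_combination[of x z 1 0 0] nbr_avg_combination[of y z 1 0 0] assms by simp
qed

text \<open>The eigenvalue \<open>0\<close> function \<open>e\<^sub>u - e\<^sub>w\<close> for \<open>u\<close> and \<open>w\<close> in one part locates \<open>y\<close>. If \<open>y\<close> is in
  another part than \<open>x\<close>, then \<open>u = y\<close> gives \<open>0 = 1\<close>. If \<open>y\<close> is in the part of \<open>x\<close> but is not \<open>x\<close>,
  then \<open>u = x\<close>, \<open>w = y\<close> gives \<open>T\<^sub>n(0) = -1\<close>, whereas a third vertex \<open>w\<close> of that part would give
  \<open>T\<^sub>n(0) = 0\<close>.\<close>

theorem pst_imp:
  assumes "x \<in> verts (multipartite r m)" "y \<in> verts (multipartite r m)" "n \<ge> 1"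
    and "pst (multipartite r m) (vertex_state (multipartite r m) x) (vertex_state (multipartite r m) y) n"
  shows "chebyshev n (- 1 / of_nat (r - 1) :: complex) = 1"
    and "y \<noteq> x \<Longrightarrow> m = 2 \<and> chebyshev n (0 :: complex) = - 1"
proof -
  obtain \<gamma> where "cmod \<gamma> = 1" and \<gamma>: 
    "\<And>\<phi> c. (\<And>z. z \<in> verts (multipartite r m) \<Longrightarrow> nbr_avg \<phi> z = c * \<phi> z) \<Longrightarrow> chebyshev n c * \<phi> x = \<gamma> * \<phi> y"
    using pst_eigenfunctions[OF assms] by metis
  have "nbr_avg (\<lambda>z. 1) z = 1 * 1" if "z \<in> verts (multipartite r m)" for z
    using nbr_avg_combination[of z z 0 0 1] that by simp
  then have [simp]: "\<gamma> = 1" using \<gamma>[of "\<lambda>z. 1" 1] by (simp add: chebyshev_one)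
  have other: "\<exists>w \<in> verts (multipartite r m). fst w = fst z \<and> w \<noteq> z" if "z \<in> verts (multipartite r m)" for z
    using that m
    by (intro bexI[of _ "(fst z, if snd z = 1 then 2 else 1)"]) (cases z, auto simp: verts_multipartite)+
  have diff: "chebyshev n 0 * (delta u x - delta w x) = delta u y - delta w y"
    if "u \<in> verts (multipartite r m)" "w \<in> verts (multipartite r m)" "fst u = fst w" for u w
    using \<gamma>[OF difference_eigenfunction[OF that]] by simp
  have same: "fst y = fst x"
  proof (rule ccontr)
    assume ne: "fst y \<noteq> fst x"
    obtain w where "w \<in> verts (multipartite r m)" "fst w = fst y" "w \<noteq> y" using other assms(2) by blast
    moreover from this ne have "y \<noteq> x" "w \<noteq> x" by auto
    ultimately show False using diff[of y w] assms(2) by (auto simp: delta_def)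
  qed
  show "chebyshev n (- 1 / of_nat (r - 1) :: complex) = 1"
  proof -
    have "of_nat r \<noteq> (1::complex)" using r by auto
    moreover have "chebyshev n (- 1 / of_nat (r - 1)) * (of_nat r - 1) = (of_nat r - 1 :: complex)"
      using \<gamma>[OF part_eigenfunction[OF assms(1)]] same by (simp add: delta_def)
    ultimately show ?thesis by (metis mult_cancel_right1 right_minus_eq)
  qed
  assume "y \<noteq> x"
  have c: "chebyshev n (0 :: complex) = - 1"
    using diff[of x y] assms same \<open>y \<noteq> x\<close> by (simp add: delta_def)
  have "m = 2"
  proof (rule ccontr)
    assume "m \<noteq> 2"
    then have "card {snd x, snd y} < card {1..m}"
      using m by (simp add: card_insert_if)
    then obtain l where "l \<in> {1..m}" "l \<notin> {snd x, snd y}"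
      by (metis card_mono finite.emptyI finite.insertI not_le subsetI)
    then show False
      using diff[of x "(fst x, l)"] assms c \<open>y \<noteq> x\<close> by (auto simp: delta_def verts_multipartite)
  qed
  then show "m = 2 \<and> chebyshev n (0 :: complex) = - 1" using c by simp
qed

text \<open>The recursion \<open>g\<^sub>n\<^sub>+\<^sub>2 = 2 P g\<^sub>n\<^sub>+\<^sub>1 - g\<^sub>n\<close> in coordinates, so that the walk on a concrete graph can
  be followed by arithmetic on triples of numbers.\<close>

lemma wave_combination_step:
  assumes "x \<in> verts (multipartite r m)"
    and "\<And>z. z \<in> verts (multipartite r m) \<Longrightarrow> wave f n z = a * delta x z + b * delta (fst x) (fst z) + c"
    and "\<And>z. z \<in> verts (multipartite r m) \<Longrightarrow> wave f (Suc n) z = a' * delta x z + b' * delta (fst x) (fst z) + c'"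
    and "s = 2 * (a' + b' * m) / k"
    and "z \<in> verts (multipartite r m)"
  shows "wave f (Suc (Suc n)) z = (- a) * delta x z + (- s - b) * delta (fst x) (fst z) + (2 * c' + s - c)"
proof -
  have "nbr_avg (wave f (Suc n)) z =
     nbr_avg (\<lambda>w. a' * delta x w + b' * delta (fst x) (fst w) + c') z"
    using assms(3) by (rule nbr_avg_cong)
  also have "\<dots> = c' + s / 2 * (1 - delta (fst x) (fst z))"
    unfolding nbr_avg_combination[OF assms(1,5)] assms(4) using k_pos by (simp add: field_simps)
  finally have avg: "nbr_avg (wave f (Suc n)) z = c' + s / 2 * (1 - delta (fst x) (fst z))" .
  show ?thesis
    unfolding wave.simps avg assms(2)[OF assms(5)] by (simp add: algebra_simps)
qed

lemma wave_0_1: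
  "wave (delta x) 0 z = 0 * delta x z + 0 * delta (fst x) (fst z) + 0"
  "wave (delta x) (Suc 0) z = 1 * delta x z + 0 * delta (fst x) (fst z) + 0"
  by simp_all

end

text \<open>Here \<open>g\<^sub>2(u) - g\<^sub>1(v)\<close> is the indicator that \<open>u\<close> is outside the part of \<open>(1, 1)\<close> minus the
  indicator of \<open>v = (1, 1)\<close>. With only two parts, \<open>u\<close> is outside exactly when its neighbour \<open>v\<close> is
  inside, which leaves the indicator of \<open>v = (1, 2)\<close>.\<close>

theorem pst_complete_bipartite_2_2:
  "pst (multipartite 2 2) (vertex_state (multipartite 2 2) (1, 1))
     (vertex_state (multipartite 2 2) (1, 2)) 2"
proof -
  interpret multipartite_graph 2 2 2 by standard simp_all
  let ?x = "(1, 1) :: nat \<times> nat" and ?y = "(1, 2) :: nat \<times> nat"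
  let ?V = "verts (multipartite 2 2)"
  have x: "?x \<in> ?V" and y: "?y \<in> ?V" by (auto simp: verts_multipartite)
  note step = wave_combination_step[OF x]
  have w2: "wave (delta ?x) (Suc (Suc 0)) z = 0 * delta ?x z + (-1) * delta (fst ?x) (fst z) + 1"
    if "z \<in> ?V" for z
    using step[OF wave_0_1, of 1, OF _ that] by simp
  have "wave (delta ?x) (Suc (Suc 0)) u - wave (delta ?x) (Suc 0) v = 1 * delta ?y v"
    if "(u, v) \<in> arcs (multipartite 2 2)" for u v
  proof -
    have "u \<in> ?V" "v \<in> ?V" "fst u \<noteq> fst v" using that by (simp_all add: arcs_multipartite)
    then show ?thesis
      unfolding w2[OF \<open>u \<in> ?V\<close>] wave_0_1 by (cases u; cases v) (auto simp: delta_def verts_multipartite)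
  qed
  then have "pst (multipartite 2 2) (vertex_state (multipartite 2 2) ?x)
     (vertex_state (multipartite 2 2) ?y) (Suc (Suc 0))"
    unfolding pst_vertex_states_iff[OF x y] by (intro exI[of _ 1]) (auto simp del: wave.simps)
  then show ?thesis by (simp only: numeral_2_eq_2)
qed

text \<open>The graph \<open>\<Gamma>\<^sub>3\<^sub>,\<^sub>2\<close> is the octahedron. After six steps \<open>g\<^sub>6\<close> is the constant \<open>1\<close> and \<open>1 - g\<^sub>5\<close>
  is the indicator of the part of \<open>(1, 1)\<close> minus the unit vector at \<open>(1, 1)\<close>, which is the
  antipodal unit vector.\<close>

theorem pst_octahedron:
  "pst (multipartite 3 2) (vertex_state (multipartite 3 2) (1, 1))
     (vertex_state (multipartite 3 2) (1, 2)) 6"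
proof -
  interpret multipartite_graph 3 2 4 by standard simp_all
  let ?x = "(1, 1) :: nat \<times> nat" and ?y = "(1, 2) :: nat \<times> nat"
  let ?V = "verts (multipartite 3 2)"
  have x: "?x \<in> ?V" and y: "?y \<in> ?V" by (auto simp: verts_multipartite)
  note step = wave_combination_step[OF x]
  let ?g = "wave (delta ?x)" and ?p = "\<lambda>z. delta (fst ?x) (fst z)"
  have w2: "?g (Suc (Suc 0)) z = 0 * delta ?x z + (-1/2) * ?p z + 1/2" if "z \<in> ?V" for z
    using step[OF wave_0_1, of "1/2", OF _ that] by simp
  have w3: "?g (Suc (Suc (Suc 0))) z = (-1) * delta ?x z + 1/2 * ?p z + 1/2" if "z \<in> ?V" for z
    using step[OF wave_0_1(2) w2, of "-1/2", OF _ _ that] by simp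
  have w4: "?g (Suc (Suc (Suc (Suc 0)))) z = 0 * delta ?x z + 1/2 * ?p z + 1/2" if "z \<in> ?V" for z
    using step[OF w2 w3, of 0, OF _ _ _ that] by simp
  have w5: "?g (Suc (Suc (Suc (Suc (Suc 0))))) z = 1 * delta ?x z + (-1) * ?p z + 1" if "z \<in> ?V" for z
    using step[OF w3 w4, of "1/2", OF _ _ _ that] by simp
  have w6: "?g (Suc (Suc (Suc (Suc (Suc (Suc 0)))))) z = 0 * delta ?x z + 0 * ?p z + 1" if "z \<in> ?V" for z
    using step[OF w4 w5, of "-1/2", OF _ _ _ that] by simp
  have "?g (Suc (Suc (Suc (Suc (Suc (Suc 0)))))) u - ?g (Suc (Suc (Suc (Suc (Suc 0))))) v = 1 * delta ?y v"
    if "(u, v) \<in> arcs (multipartite 3 2)" for u v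
  proof -
    have "u \<in> ?V" "v \<in> ?V" using that by (simp_all add: arcs_multipartite)
    then show ?thesis
      unfolding w5[OF \<open>v \<in> ?V\<close>] w6[OF \<open>u \<in> ?V\<close>]
      by (cases v) (auto simp: delta_def verts_multipartite)
  qed
  then have "pst (multipartite 3 2) (vertex_state (multipartite 3 2) ?x)
     (vertex_state (multipartite 3 2) ?y) (Suc (Suc (Suc (Suc (Suc (Suc 0))))))"
    unfolding pst_vertex_states_iff[OF x y] by (intro exI[of _ 1]) (auto simp del: wave.simps)
  then show ?thesis by (simp add: eval_nat_numeral)
qed

section \<open>Perfect state transfer on complete multipartite graphs\<close>

theorem theorem1p2:
  shows
    "(\<forall>r m. r \<ge> 2 \<and> m \<ge> 2 \<longrightarrow>
        (\<exists>x \<in> verts (multipartite r m). \<exists>y \<in> verts (multipartite r m). \<exists>\<tau> \<ge> 1.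
           pst (multipartite r m) (vertex_state (multipartite r m) x)
             (vertex_state (multipartite r m) y) \<tau>) \<longrightarrow>
        r \<in> {2, 3})
     \<and>
     ((\<forall>m \<ge> 2. \<forall>\<tau> \<in> {1, 2, 3}.
         (\<exists>y \<in> verts (multipartite 2 m). y \<noteq> (1, 1) \<and>
            pst (multipartite 2 m) (vertex_state (multipartite 2 m) (1, 1))
              (vertex_state (multipartite 2 m) y) \<tau>)
         \<longleftrightarrow> m = 2 \<and> \<tau> = 2)
      \<and> pst (multipartite 2 2) (vertex_state (multipartite 2 2) (1, 1))
          (vertex_state (multipartite 2 2) (1, 2)) 2)
     \<and>
     ((\<forall>m \<ge> 2. \<forall>\<tau> \<in> {1..11}.
         (\<exists>y \<in> verts (multipartite 3 m). y \<noteq> (1, 1) \<and>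
            pst (multipartite 3 m) (vertex_state (multipartite 3 m) (1, 1))
              (vertex_state (multipartite 3 m) y) \<tau>)
         \<longleftrightarrow> m = 2 \<and> \<tau> = 6)
      \<and> pst (multipartite 3 2) (vertex_state (multipartite 3 2) (1, 1))
          (vertex_state (multipartite 3 2) (1, 2)) 6)"
proof (intro conjI allI impI ballI)
  fix r m :: nat
  let ?G = "multipartite r m"
  assume rm: "r \<ge> 2 \<and> m \<ge> 2"
    and "\<exists>x \<in> verts ?G. \<exists>y \<in> verts ?G. \<exists>\<tau> \<ge> 1. pst ?G (vertex_state ?G x) (vertex_state ?G y) \<tau>"
  then obtain x y \<tau> where p: "x \<in> verts ?G" "y \<in> verts ?G" "\<tau> \<ge> 1"
    "pst ?G (vertex_state ?G x) (vertex_state ?G y) \<tau>" by blast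
  interpret multipartite_graph r m "(r - 1) * m" using rm by unfold_locales auto
  have "r - 1 \<ge> 1" using rm by arith
  then have "r - 1 \<in> {1, 2}"
    using p(3) pst_imp(1)[OF p] by (rule chebyshev_neg_inverse_eq_1)
  then show "r \<in> {2, 3}" by auto
next
  fix m \<tau> :: nat
  assume m: "m \<ge> 2" and \<tau>: "\<tau> \<in> {1, 2, 3}"
  interpret multipartite_graph 2 m "(2 - 1) * m" using m by unfold_locales auto
  have x: "(1, 1) \<in> verts (multipartite 2 m)" using m by (simp add: verts_multipartite)
  show "(\<exists>y \<in> verts (multipartite 2 m). y \<noteq> (1, 1) \<and>
            pst (multipartite 2 m) (vertex_state (multipartite 2 m) (1, 1))
              (vertex_state (multipartite 2 m) y) \<tau>)
         \<longleftrightarrow> m = 2 \<and> \<tau> = 2" (is "?L \<longleftrightarrow> ?R")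
  proof
    assume ?L
    then obtain y where y: "y \<in> verts (multipartite 2 m)" "y \<noteq> (1, 1)"
      "pst (multipartite 2 m) (vertex_state (multipartite 2 m) (1, 1))
        (vertex_state (multipartite 2 m) y) \<tau>" by blast
    have "\<tau> \<ge> 1" using \<tau> by auto
    note imp = pst_imp[OF x y(1) this y(3)]
    have "m = 2" "chebyshev \<tau> (0 :: complex) = - 1"
      using imp(2)[OF y(2)] by simp_all
    then show ?R using \<tau> by (auto simp: eval_nat_numeral)
  next
    assume ?R
    then show ?L
      using pst_complete_bipartite_2_2 by (intro bexI[of _ "(1, 2)"]) (auto simp: verts_multipartite)
  qed
next
  fix m \<tau> :: nat
  assume m: "m \<ge> 2" and \<tau>: "\<tau> \<in> {1..11}"
  interpret multipartite_graph 3 m "(3 - 1) * m" using m by unfold_locales auto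
  have x: "(1, 1) \<in> verts (multipartite 3 m)" using m by (simp add: verts_multipartite)
  show "(\<exists>y \<in> verts (multipartite 3 m). y \<noteq> (1, 1) \<and>
            pst (multipartite 3 m) (vertex_state (multipartite 3 m) (1, 1))
              (vertex_state (multipartite 3 m) y) \<tau>)
         \<longleftrightarrow> m = 2 \<and> \<tau> = 6" (is "?L \<longleftrightarrow> ?R")
  proof
    assume ?L
    then obtain y where y: "y \<in> verts (multipartite 3 m)" "y \<noteq> (1, 1)"
      "pst (multipartite 3 m) (vertex_state (multipartite 3 m) (1, 1))
        (vertex_state (multipartite 3 m) y) \<tau>" by blast
    have "\<tau> \<ge> 1" using \<tau> by auto
    note imp = pst_imp[OF x y(1) this y(3)]
    have c: "m = 2" "chebyshev \<tau> (0 :: complex) = - 1" "chebyshev \<tau> (- 1 / 2 :: complex) = 1"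
      using imp(1) imp(2)[OF y(2)] by simp_all
    have "\<tau> \<in> {1, 2, 3, 4, 5, 6, 7, 8, 9, 10, 11}"
      using \<tau> unfolding atLeastAtMost_iff insert_iff empty_iff by arith
    moreover have "- (1 / 2) \<noteq> (1 :: complex)" by (simp add: complex_eq_iff)
    ultimately show ?R using c by (auto simp: eval_nat_numeral)
  next
    assume ?R
    then show ?L
      using pst_octahedron by (intro bexI[of _ "(1, 2)"]) (auto simp: verts_multipartite)
  qed
qed (rule pst_complete_bipartite_2_2 pst_octahedron)+

end
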